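(* Let $\mathcal{G}(p)$ be a framework in $\mathbb{R}^2$ with $n\ge 2$ vertices. Then $\mathcal{G}(p)$ is infinitesimally bearing rigid if and only if it is infinitesimally distance rigid.
   Context: Let $\mathcal{G}=(\mathcal{V},\mathcal{E})$ be an undirected graph without self-loops, $\mathcal{V}=\{1,\dots,n\}$, with $m$ edges. A configuration in $\mathbb{R}^2$ is $p=[p_1^{\mathrm T},\dots,p_n^{\mathrm T}]^{\mathrm T}\in\mathbb{R}^{2n}$; a framework $\mathcal{G}(p)$ is the graph together with a configuration such that $p_i\neq p_j$ for all $(i,j)\in\mathcal{E}$. $\mathbf{1}=[1,\dots,1]^{\mathrm T}\in\mathbb{R}^n$. Fix an arbitrary orientation of $\mathcal{G}$; for the $k$th directed edge, from $i$ to $j$, let $e_k=p_j-p_i$ and $g_k=e_k/\|e_k\|$. Bearing side: $R(p)=\partial F_B(p)/\partial p\in\mathbb{R}^{2m\times 2n}$ is the Jacobian of $F_B(p)=[g_1^{\mathrm T},\dots,g_m^{\mathrm T}]^{\mathrm T}$. A vector $\delta p$ with $R(p)\delta p=0$ is an infinitesimal bearing motion; it is trivial if it corresponds to a translation and a scaling of the framework, i.e. $\delta p=\mathbf{1}\otimes x+\alpha p$ with $x\in\mathbb{R}^2,\alpha\in\mathbb{R}$. $\mathcal{G}(p)$ is infinitesimally bearing rigid if all its infinitesimal bearing motions are trivial. Distance side: $R_D(p)=\partial F_D(p)/\partial p\in\mathbb{R}^{m\times 2n}$ is the Jacobian of $F_D(p)=\frac12[\|e_1\|^2,\dots,\|e_m\|^2]^{\mathrm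 T}$. A vector $\delta p$ with $R_D(p)\delta p=0$ is an infinitesimal distance motion. $\mathcal{G}(p)$ is infinitesimally distance rigid if all its infinitesimal distance motions correspond to rigid-body rotations and translations, i.e. are of the form $\delta p=\mathbf{1}\otimes x+\alpha (I_n\otimes Q_{\pi/2})p$ with $x\in\mathbb{R}^2$, $\alpha\in\mathbb{R}$, where $Q_{\pi/2}$ is the $2\times2$ rotation matrix by $\pi/2$. *)

theory Defs
  imports "HOL-Analysis.Analysis"
begin

text \<open>A finite vertex type \<open>'n\<close> stands for the vertex set, so the number of
  vertices is \<open>CARD('n)\<close>.  An undirected graph without self-loops is its set of edges,
  each of them a two-element set of vertices.\<close>

definition simple_graph :: "'n set set \<Rightarrow> bool" where
  "simple_graph E \<longleftrightarrow> (\<forall>e\<in>E. card e = 2)"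

text \<open>An orientation picks exactly one ordered pair \<open>(i, j)\<close> for each edge \<open>{i, j}\<close>.\<close>

definition orientation :: "'n set set \<Rightarrow> ('n \<times> 'n) set \<Rightarrow> bool" where
  "orientation E D \<longleftrightarrow> bij_betw (\<lambda>(i, j). {i, j}) D E"

text \<open>A configuration is the stacked vector of all coordinates: the entry at \<open>(i, c)\<close> is
  the coordinate \<open>c\<close> of the point at vertex \<open>i\<close>.\<close>

type_synonym 'n config = "real ^ ('n \<times> 2)"

definition pos :: "'n::finite config \<Rightarrow> 'n \<Rightarrow> real ^ 2" where
  "pos p i = (\<chi> c. p $ (i, c))"

definition framework :: "'n set set \<Rightarrow> 'n::finite config \<Rightarrow> bool" where
  "framework E p \<longleftrightarrow> simple_graph E \<and> (\<forall>i j. {i, j} \<in> E \<longrightarrow> pos p i \<noteq> pos p j)"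

definition edge_vec :: "'n::finite config \<Rightarrow> 'n \<times> 'n \<Rightarrow> real ^ 2" where
  "edge_vec p k = pos p (snd k) - pos p (fst k)"

definition bearing :: "'n::finite config \<Rightarrow> 'n \<times> 'n \<Rightarrow> real ^ 2" where
  "bearing p k = edge_vec p k /\<^sub>R norm (edge_vec p k)"

text \<open>The number of edges is not fixed by a type (and may be zero), so the rows of the bearing
  and distance functions are indexed by all ordered pairs of vertices, and the rows of pairs
  that are not oriented edges are constantly zero.  These contribute only zero rows to the
  Jacobians and hence do not affect their kernels.\<close>

definition bearing_fun ::
    "('n \<times> 'n) set \<Rightarrow> 'n::finite config \<Rightarrow> real ^ (('n \<times> 'n) \<times> 2)" where
  "bearing_fun D p = (\<chi> r. if fst r \<in> D then bearing p (fst r) $ snd r else 0)"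

definition distance_fun ::
    "('n \<times> 'n) set \<Rightarrow> 'n::finite config \<Rightarrow> real ^ ('n \<times> 'n)" where
  "distance_fun D p = (\<chi> k. if k \<in> D then 1 / 2 * (norm (edge_vec p k))\<^sup>2 else 0)"

definition bearing_matrix ::
    "('n \<times> 'n) set \<Rightarrow> 'n::finite config \<Rightarrow> real ^ ('n \<times> 2) ^ (('n \<times> 'n) \<times> 2)" where
  "bearing_matrix D p = jacobian (bearing_fun D) (at p)"

definition distance_matrix ::
    "('n \<times> 'n) set \<Rightarrow> 'n::finite config \<Rightarrow> real ^ ('n \<times> 2) ^ ('n \<times> 'n)" where
  "distance_matrix D p = jacobian (distance_fun D) (at p)"

definition kron_vec :: "real ^ 'a \<Rightarrow> real ^ 'b \<Rightarrow> real ^ ('a::finite \<times> 'b::finite)" where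
  "kron_vec a b = (\<chi> r. a $ fst r * b $ snd r)"

definition kron_mat ::
    "real ^ 'b ^ 'a \<Rightarrow> real ^ 'd ^ 'c \<Rightarrow>
      real ^ ('b::finite \<times> 'd::finite) ^ ('a::finite \<times> 'c::finite)" where
  "kron_mat A B = (\<chi> r s. A $ fst r $ fst s * B $ snd r $ snd s)"

definition rotation_matrix :: "real \<Rightarrow> real ^ 2 ^ 2" where
  "rotation_matrix \<theta> = vector [vector [cos \<theta>, - sin \<theta>], vector [sin \<theta>, cos \<theta>]]"

definition infinitesimal_bearing_motion ::
    "('n \<times> 'n) set \<Rightarrow> 'n::finite config \<Rightarrow> 'n config \<Rightarrow> bool" where
  "infinitesimal_bearing_motion D p \<delta> \<longleftrightarrow> bearing_matrix D p *v \<delta> = 0"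

definition infinitesimal_distance_motion ::
    "('n \<times> 'n) set \<Rightarrow> 'n::finite config \<Rightarrow> 'n config \<Rightarrow> bool" where
  "infinitesimal_distance_motion D p \<delta> \<longleftrightarrow> distance_matrix D p *v \<delta> = 0"

text \<open>In the next two definitions \<open>1 :: real ^ 'n\<close> is the all-ones vector, while
  \<open>mat 1\<close> is the identity matrix.\<close>

definition trivial_bearing_motion :: "'n::finite config \<Rightarrow> 'n config \<Rightarrow> bool" where
  "trivial_bearing_motion p \<delta> \<longleftrightarrow>
    (\<exists>x \<alpha>. \<delta> = kron_vec (1 :: real ^ 'n) x + \<alpha> *\<^sub>R p)"

definition trivial_distance_motion :: "'n::finite config \<Rightarrow> 'n config \<Rightarrow> bool" where
  "trivial_distance_motion p \<delta> \<longleftrightarrow>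
    (\<exists>x \<alpha>. \<delta> = kron_vec (1 :: real ^ 'n) x +
      \<alpha> *\<^sub>R (kron_mat (mat 1 :: real ^ 'n ^ 'n) (rotation_matrix (pi / 2)) *v p))"

definition infinitesimally_bearing_rigid ::
    "('n \<times> 'n) set \<Rightarrow> 'n::finite config \<Rightarrow> bool" where
  "infinitesimally_bearing_rigid D p \<longleftrightarrow>
    (\<forall>\<delta>. infinitesimal_bearing_motion D p \<delta> \<longrightarrow> trivial_bearing_motion p \<delta>)"

definition infinitesimally_distance_rigid ::
    "('n \<times> 'n) set \<Rightarrow> 'n::finite config \<Rightarrow> bool" where
  "infinitesimally_distance_rigid D p \<longleftrightarrow>
    (\<forall>\<delta>. infinitesimal_distance_motion D p \<delta> \<longrightarrow> trivial_distance_motion p \<delta>)"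

end

theory Submission
  imports Defs
begin

text \<open>Rotating every velocity of a motion by \<open>\<pi>/2\<close> turns ``the relative velocity is parallel to
  the edge'', the condition for a bearing motion, into ``the relative velocity is orthogonal to
  the edge'', the condition for a distance motion; it likewise exchanges the two kinds of trivial
  motions.  The rotation squares to \<open>-1\<close>, so it is a bijection on motions.\<close>

section \<open>Derivatives and the action of the two Jacobians\<close>

lemma bounded_linear_pos: "bounded_linear (\<lambda>p. pos p i)"
  unfolding pos_def linear_conv_bounded_linear[symmetric]
  by (rule linearI) (auto simp: vec_eq_iff)

lemma bounded_linear_edge_vec: "bounded_linear (\<lambda>p. edge_vec p k)"
  unfolding edge_vec_def by (intro bounded_linear_sub bounded_linear_pos)

lemmas edge_vec_has_derivative = bounded_linear_imp_has_derivative[OF bounded_linear_edge_vec]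

text \<open>Differentiability is tested against basis vectors, and those of \<open>real ^ 'b\<close>
  are the axis vectors, whose inner products pick out single coordinates.\<close>

lemma has_derivative_vec_lambda:
  fixes f :: "'a::real_normed_vector \<Rightarrow> 'b::finite \<Rightarrow> real"
  assumes "\<And>r. ((\<lambda>x. f x r) has_derivative (\<lambda>h. f' h r)) (at x within S)"
  shows "((\<lambda>x. \<chi> r. f x r) has_derivative (\<lambda>h. \<chi> r. f' h r)) (at x within S)"
proof -
  have "((\<lambda>x. (\<chi> r. f x r) \<bullet> b) has_derivative (\<lambda>h. (\<chi> r. f' h r) \<bullet> b)) (at x within S)"
    if "b \<in> Basis" for b :: "real ^ 'b"
  proof -
    from that obtain r where "b = axis r 1"
      by (auto simp: Basis_vec_def)
    then show ?thesis
      using assms[of r] by (simp add: inner_axis)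
  qed
  then show ?thesis
    by (subst has_derivative_componentwise_within) blast
qed

text \<open>\<open>jacobian\<close> is the matrix of some derivative, and derivatives at a point are
  unique. Any explicitly computed derivative can thus replace it.\<close>

lemma jacobian_mult_vec:
  fixes f :: "real ^ 'a::finite \<Rightarrow> real ^ 'b::finite"
  assumes "(f has_derivative f') (at x)"
  shows "jacobian f (at x) *v h = f' h"
proof -
  have "f differentiable at x"
    using assms by (auto simp: differentiable_def)
  then have "(f has_derivative (\<lambda>h. jacobian f (at x) *v h)) (at x)"
    by (simp add: jacobian_works)
  then show ?thesis
    using has_derivative_unique[OF assms] by (metis)
qed

text \<open>The product rule, with \<open>- (v \<bullet> h) / norm v ^ 3\<close> as the derivative
  of \<open>1 / norm v\<close>. The result is the component of \<open>h\<close> orthogonal to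
  \<open>v\<close>, divided by \<open>norm v\<close>.\<close>

lemma normalize_has_derivative:
  fixes v :: "'a::real_inner"
  assumes "v \<noteq> 0"
  shows "((\<lambda>v. v /\<^sub>R norm v) has_derivative
    (\<lambda>h. h /\<^sub>R norm v - ((v \<bullet> h) / norm v ^ 3) *\<^sub>R v)) (at v)"
proof -
  have "(norm has_derivative (\<lambda>h. v \<bullet> h / norm v)) (at v)"
    using has_derivative_norm[OF assms] by (simp add: sgn_div_norm divide_inverse_commute inner_commute)
  then show ?thesis
    using assms
    by (auto intro!: derivative_eq_intros ext simp: power3_eq_cube divide_inverse algebra_simps)
qed

lemma bearing_has_derivative:
  assumes "edge_vec p k \<noteq> 0"
  shows "((\<lambda>p. bearing p k) has_derivative
    (\<lambda>h. edge_vec h k /\<^sub>R norm (edge_vec p k)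
      - ((edge_vec p k \<bullet> edge_vec h k) / norm (edge_vec p k) ^ 3) *\<^sub>R edge_vec p k)) (at p)"
  unfolding bearing_def
  using has_derivative_compose[OF edge_vec_has_derivative normalize_has_derivative[OF assms]] .

lemma distance_matrix_mult_vec:
  "distance_matrix D p *v \<delta> = (\<chi> k. if k \<in> D then edge_vec p k \<bullet> edge_vec \<delta> k else 0)"
  unfolding distance_matrix_def distance_fun_def [abs_def]
proof (rule jacobian_mult_vec, rule has_derivative_vec_lambda)
  fix k
  have "((\<lambda>p. 1 / 2 * (norm (edge_vec p k))\<^sup>2) has_derivative
    (\<lambda>\<delta>. edge_vec p k \<bullet> edge_vec \<delta> k)) (at p)"
    \<comment> \<open>The factor 1/2 cancels the two equal terms that the product rule gives for the
      inner product.\<close>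
    unfolding power2_norm_eq_inner
    by (rule derivative_eq_intros edge_vec_has_derivative refl)+ (simp add: inner_commute fun_eq_iff)
  then show "((\<lambda>p. if k \<in> D then 1 / 2 * (norm (edge_vec p k))\<^sup>2 else 0) has_derivative
    (\<lambda>\<delta>. if k \<in> D then edge_vec p k \<bullet> edge_vec \<delta> k else 0)) (at p)"
    by (cases "k \<in> D") simp_all
qed

lemma bearing_matrix_mult_vec:
  assumes "\<And>k. k \<in> D \<Longrightarrow> edge_vec p k \<noteq> 0"
  shows "bearing_matrix D p *v \<delta> = (\<chi> r. if fst r \<in> D then
    (edge_vec \<delta> (fst r) /\<^sub>R norm (edge_vec p (fst r))
      - ((edge_vec p (fst r) \<bullet> edge_vec \<delta> (fst r)) / norm (edge_vec p (fst r)) ^ 3)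
        *\<^sub>R edge_vec p (fst r)) $ snd r else 0)"
  unfolding bearing_matrix_def bearing_fun_def [abs_def]
proof (rule jacobian_mult_vec, rule has_derivative_vec_lambda)
  fix r :: "('a \<times> 'a) \<times> 2"
  show "((\<lambda>p. if fst r \<in> D then bearing p (fst r) $ snd r else 0) has_derivative
    (\<lambda>\<delta>. if fst r \<in> D then (edge_vec \<delta> (fst r) /\<^sub>R norm (edge_vec p (fst r))
      - ((edge_vec p (fst r) \<bullet> edge_vec \<delta> (fst r)) / norm (edge_vec p (fst r)) ^ 3)
        *\<^sub>R edge_vec p (fst r)) $ snd r else 0)) (at p)"
  proof (cases "fst r \<in> D")
    case True
    then show ?thesis
      using bounded_linear.has_derivative[OF bounded_linear_vec_nth
          bearing_has_derivative[OF assms[OF True]]] by simp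
  qed simp
qed

section \<open>The quarter turn on vectors and on configurations\<close>

definition rot :: "real ^ 2 \<Rightarrow> real ^ 2" where
  "rot v = rotation_matrix (pi / 2) *v v"

lemma rot_nth [simp]: "rot v $ 1 = - v $ 2" "rot v $ 2 = v $ 1"
  by (simp_all add: rot_def rotation_matrix_def matrix_vector_mult_def sum_2)

text \<open>In the plane the component of \<open>h\<close> orthogonal to \<open>v\<close> is a
  multiple of \<open>rot v\<close>, and its coefficient is a nonzero multiple of
  \<open>v \<bullet> rot h\<close>. This is where dimension two enters.\<close>

lemma tangential_part_zero_iff:
  fixes v h :: "real ^ 2"
  assumes "v \<noteq> 0"
  shows "h /\<^sub>R norm v - ((v \<bullet> h) / norm v ^ 3) *\<^sub>R v = 0 \<longleftrightarrow> v \<bullet> rot h = 0"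
proof -
  have n: "norm v > 0" using assms by simp
  have "h /\<^sub>R norm v - ((v \<bullet> h) / norm v ^ 3) *\<^sub>R v
      = ((norm v)\<^sup>2 *\<^sub>R h - (v \<bullet> h) *\<^sub>R v) /\<^sub>R norm v ^ 3"
    using n by (simp add: scaleR_diff_right field_simps power2_eq_square power3_eq_cube)
  \<comment> \<open>A polynomial identity in the four coordinates of \<open>v\<close> and
    \<open>h\<close>.\<close>
  also have "(norm v)\<^sup>2 *\<^sub>R h - (v \<bullet> h) *\<^sub>R v = - (v \<bullet> rot h) *\<^sub>R rot v"
    unfolding power2_norm_eq_inner
    by (simp add: vec_eq_iff forall_2 inner_vec_def sum_2 algebra_simps)
  finally have "h /\<^sub>R norm v - ((v \<bullet> h) / norm v ^ 3) *\<^sub>R v = (- (v \<bullet> rot h) *\<^sub>R rot v) /\<^sub>R norm v ^ 3" .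
  moreover have "rot v \<noteq> 0"
    using assms by (auto simp: vec_eq_iff forall_2)
  ultimately show ?thesis
    using n by simp
qed

text \<open>The block-diagonal matrix is the one in \<open>trivial_distance_motion\<close>, so the
  rotational part of a trivial motion is literally a multiple of
  \<open>rot_config p\<close>.\<close>

definition rot_config :: "'n::finite config \<Rightarrow> 'n config" where
  "rot_config \<delta> = kron_mat (mat 1 :: real ^ 'n ^ 'n) (rotation_matrix (pi / 2)) *v \<delta>"

lemma rot_config_nth:
  fixes \<delta> :: "'n::finite config"
  shows "rot_config \<delta> $ (i, c) = rot (pos \<delta> i) $ c"
proof -
  have "rot_config \<delta> $ (i, c)
      = (\<Sum>s\<in>UNIV \<times> UNIV. mat 1 $ i $ fst s * rotation_matrix (pi / 2) $ c $ snd s * \<delta> $ s)"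
    by (simp add: rot_config_def kron_mat_def matrix_vector_mult_def)
  also have "\<dots> = (\<Sum>j\<in>UNIV. \<Sum>d\<in>UNIV.
      (mat 1 :: real ^ 'n ^ 'n) $ i $ j * rotation_matrix (pi / 2) $ c $ d * \<delta> $ (j, d))"
    by (subst sum.cartesian_product) (simp add: case_prod_beta)
  \<comment> \<open>The identity factor of the Kronecker product leaves only the diagonal block at
    \<open>i\<close>.\<close>
  also have "\<dots> = (\<Sum>j\<in>UNIV. if i = j then
      (\<Sum>d\<in>UNIV. rotation_matrix (pi / 2) $ c $ d * \<delta> $ (j, d)) else 0)"
    by (intro sum.cong) (auto simp: mat_def)
  also have "\<dots> = rot (pos \<delta> i) $ c"
    by (simp add: rot_def pos_def matrix_vector_mult_def)
  finally show ?thesis .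
qed

lemma pos_rot_config: "pos (rot_config \<delta>) i = rot (pos \<delta> i)"
  by (simp add: vec_eq_iff pos_def rot_config_nth[unfolded pos_def])

lemma edge_vec_rot_config: "edge_vec (rot_config \<delta>) k = rot (edge_vec \<delta> k)"
  by (simp add: edge_vec_def pos_rot_config rot_def matrix_vector_mult_diff_distrib)

lemma rot_config_add: "rot_config (a + b) = rot_config a + rot_config b"
  by (simp add: rot_config_def matrix_vector_right_distrib)

lemma rot_config_scaleR: "rot_config (c *\<^sub>R a) = c *\<^sub>R rot_config a"
  by (simp add: rot_config_def matrix_vector_mult_scaleR)

text \<open>\<open>kron_vec 1 x\<close> places the same vector \<open>x\<close> at every vertex, so
  a rotated translation is again a translation.\<close>

lemma rot_config_kron_one: "rot_config (kron_vec (1 :: real ^ 'n::finite) x) = kron_vec 1 (rot x)"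
proof -
  have "pos (kron_vec (1 :: real ^ 'n) x) i = x" for i
    by (simp add: vec_eq_iff pos_def kron_vec_def)
  then have "rot_config (kron_vec (1 :: real ^ 'n) x) $ (i, c) = kron_vec 1 (rot x) $ (i, c)" for i c
    by (simp only: rot_config_nth) (simp add: kron_vec_def)
  then show ?thesis
    by (simp add: vec_eq_iff)
qed

lemma rot_rot: "rot (rot v) = - v"
  by (simp add: vec_eq_iff forall_2)

lemma rot_config_rot_config: "rot_config (rot_config a) = - a"
  by (simp add: vec_eq_iff rot_config_nth pos_rot_config rot_rot) (simp add: pos_def)

section \<open>Correspondence of motions and of trivial motions\<close>

lemma infinitesimal_distance_motion_iff:
  "infinitesimal_distance_motion D p \<delta> \<longleftrightarrow> (\<forall>k\<in>D. edge_vec p k \<bullet> edge_vec \<delta> k = 0)"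
  by (auto simp: infinitesimal_distance_motion_def distance_matrix_mult_vec vec_eq_iff)

text \<open>Both kernels split into one condition per oriented edge, the padding rows being zero;
  edge by edge the conditions agree by \<open>tangential_part_zero_iff\<close>.\<close>

lemma infinitesimal_bearing_motion_iff:
  assumes "\<And>k. k \<in> D \<Longrightarrow> edge_vec p k \<noteq> 0"
  shows "infinitesimal_bearing_motion D p \<delta> \<longleftrightarrow> infinitesimal_distance_motion D p (rot_config \<delta>)"
proof -
  define w where "w k = edge_vec \<delta> k /\<^sub>R norm (edge_vec p k)
      - ((edge_vec p k \<bullet> edge_vec \<delta> k) / norm (edge_vec p k) ^ 3) *\<^sub>R edge_vec p k" for k
  have "bearing_matrix D p *v \<delta> = (\<chi> r. if fst r \<in> D then w (fst r) $ snd r else 0)"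
    unfolding w_def by (rule bearing_matrix_mult_vec) (rule assms)
  then have "infinitesimal_bearing_motion D p \<delta> \<longleftrightarrow> (\<forall>k\<in>D. w k = 0)"
    unfolding infinitesimal_bearing_motion_def by (auto simp: vec_eq_iff)
  also have "\<dots> \<longleftrightarrow> (\<forall>k\<in>D. edge_vec p k \<bullet> rot (edge_vec \<delta> k) = 0)"
    unfolding w_def using tangential_part_zero_iff assms by (intro ball_cong) blast+
  finally show ?thesis
    by (simp add: infinitesimal_distance_motion_iff edge_vec_rot_config)
qed

lemma trivial_bearing_motion_iff:
  "trivial_bearing_motion p \<delta> \<longleftrightarrow> trivial_distance_motion p (rot_config \<delta>)"
proof
  assume "trivial_bearing_motion p \<delta>"
  then obtain x \<alpha> where "\<delta> = kron_vec 1 x + \<alpha> *\<^sub>R p"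
    by (auto simp: trivial_bearing_motion_def)
  then have "rot_config \<delta> = kron_vec 1 (rot x) + \<alpha> *\<^sub>R rot_config p"
    by (simp add: rot_config_add rot_config_scaleR rot_config_kron_one)
  then show "trivial_distance_motion p (rot_config \<delta>)"
    unfolding trivial_distance_motion_def rot_config_def by blast
next
  assume "trivial_distance_motion p (rot_config \<delta>)"
  then obtain x \<alpha> where "rot_config \<delta> = kron_vec 1 x + \<alpha> *\<^sub>R rot_config p"
    by (auto simp: trivial_distance_motion_def rot_config_def)
  \<comment> \<open>A second quarter turn recovers \<delta> up to sign and turns the rotation of
    \<open>p\<close> back into a scaling.\<close>
  then have "rot_config (rot_config \<delta>) = rot_config (kron_vec 1 x + \<alpha> *\<^sub>R rot_config p)"
    by simp
  then have "- \<delta> = kron_vec 1 (rot x) - \<alpha> *\<^sub>R p"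
    by (simp add: rot_config_add rot_config_scaleR rot_config_kron_one rot_config_rot_config)
  then have "\<delta> = - kron_vec 1 (rot x) + \<alpha> *\<^sub>R p"
    by (simp add: minus_equation_iff[of \<delta>])
  \<comment> \<open>The sign is absorbed into the translation vector, giving the witness
    \<open>- rot x\<close>.\<close>
  also have "- kron_vec 1 (rot x) = kron_vec 1 (- rot x)"
    by (simp add: kron_vec_def vec_eq_iff)
  finally show "trivial_bearing_motion p \<delta>"
    unfolding trivial_bearing_motion_def by blast
qed

text \<open>The quarter turn squares to -1, so its negative is its inverse.\<close>

lemma surj_rot_config: "surj rot_config"
proof (rule surjI)
  show "rot_config (- rot_config a) = a" for a :: "'a config"
    using rot_config_scaleR[of "-1" "rot_config a"] by (simp add: rot_config_rot_config)
qed

text \<open>An orientation maps each of its pairs to an edge of \<open>E\<close>, and a framework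
  keeps the endpoints of an edge apart. Hence bearings are differentiable at
  \<open>p\<close>.\<close>

lemma framework_edge_vec_nonzero:
  assumes "framework E p" "orientation E D" "k \<in> D"
  shows "edge_vec p k \<noteq> 0"
proof -
  have "{fst k, snd k} \<in> E"
    using assms(2,3) by (force simp: orientation_def bij_betw_def case_prod_beta)
  then show ?thesis
    using assms(1) by (fastforce simp: framework_def edge_vec_def)
qed

theorem theorem8:
  fixes E :: "'n::finite set set" and D :: "('n \<times> 'n) set" and p :: "'n config"
  assumes "CARD('n) \<ge> 2"
    and "framework E p"
    and "orientation E D"
  shows "infinitesimally_bearing_rigid D p \<longleftrightarrow> infinitesimally_distance_rigid D p"
proof -
  have "infinitesimally_bearing_rigid D p \<longleftrightarrow>
    (\<forall>\<delta>. infinitesimal_distance_motion D p (rot_config \<delta>)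
      \<longrightarrow> trivial_distance_motion p (rot_config \<delta>))"
    using framework_edge_vec_nonzero[OF assms(2,3)]
    by (simp add: infinitesimally_bearing_rigid_def infinitesimal_bearing_motion_iff
        trivial_bearing_motion_iff)
  also have "\<dots> \<longleftrightarrow> infinitesimally_distance_rigid D p"
    \<comment> \<open>By surjectivity, ranging over all rotated motions is the same as ranging over
      all motions.\<close>
    unfolding infinitesimally_distance_rigid_def using surj_rot_config by (metis surjD)
  finally show ?thesis .
qed

end
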